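(* Let $A\subseteq\mathbb{R}$ be an open invex set with respect to $\eta:A\times A\to\mathbb{R}$, and let $a,b\in A$ with $a<a+\eta(b,a)$. Suppose that $f:A\to\mathbb{R}$ is a differentiable function such that $f'\in L[a,a+\eta(b,a)]$. If $|f'|^{q}$ is prequasiinvex on $A$ with respect to $\eta$ for some fixed $q>1$, then for every $\alpha>0$, $$\left|\frac{f(a)+f(a+\eta(b,a))}{2}-\frac{\Gamma(\alpha+1)}{2\,\eta(b,a)^{\alpha}}\left[J_{a^{+}}^{\alpha}f\big(a+\eta(b,a)\big)+J_{(a+\eta(b,a))^{-}}^{\alpha}f(a)\right]\right|\le\frac{\eta(b,a)}{\alpha+1}\left(1-\frac{1}{2^{\alpha}}\right)\left(\max\{|f'(a)|^{q},|f'(b)|^{q}\}\right)^{1/q}.$$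
   Context: A set $A\subseteq\mathbb{R}$ is invex with respect to $\eta:A\times A\to\mathbb{R}$ if $x+t\eta(y,x)\in A$ for all $x,y\in A$ and $t\in[0,1]$. A function $g:A\to\mathbb{R}$ on an invex set $A$ is prequasiinvex with respect to $\eta$ if $g(x+t\eta(y,x))\le\max\{g(x),g(y)\}$ for all $x,y\in A$ and $t\in[0,1]$. $L[c,d]$ denotes the Lebesgue integrable functions on $[c,d]$ (for a function with larger domain, its restriction is meant). For $f\in L[c,d]$ and $\alpha>0$ the Riemann–Liouville fractional integrals are $$J_{c^{+}}^{\alpha}f(x)=\frac{1}{\Gamma(\alpha)}\int_c^x (x-t)^{\alpha-1}f(t)\,dt\ (x>c),\qquad J_{d^{-}}^{\alpha}f(x)=\frac{1}{\Gamma(\alpha)}\int_x^d (t-x)^{\alpha-1}f(t)\,dt\ (x<d),$$ where $\Gamma$ is the Gamma function. Here they are used with $c=a$ and $d=a+\eta(b,a)$. *)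

theory Defs
  imports "HOL-Analysis.Analysis"
begin

definition invex_set :: "real set \<Rightarrow> (real \<Rightarrow> real \<Rightarrow> real) \<Rightarrow> bool" where
  "invex_set A \<eta> \<longleftrightarrow> (\<forall>x\<in>A. \<forall>y\<in>A. \<forall>t\<in>{0..1}. x + t * \<eta> y x \<in> A)"

definition prequasiinvex_on ::
    "real set \<Rightarrow> (real \<Rightarrow> real \<Rightarrow> real) \<Rightarrow> (real \<Rightarrow> real) \<Rightarrow> bool" where
  "prequasiinvex_on A \<eta> g \<longleftrightarrow> invex_set A \<eta> \<and>
     (\<forall>x\<in>A. \<forall>y\<in>A. \<forall>t\<in>{0..1}. g (x + t * \<eta> y x) \<le> max (g x) (g y))"

(* Left- and right-sided Riemann-Liouville integrals of order alpha, meant for alpha > 0 and for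
   x > c, respectively x < d.  The kernel is 0 instead of undefined or 1 at t = x when alpha <= 1,
   since 0 powr s = 0; this is a single point and does not affect the integral. *)

definition RL_left :: "real \<Rightarrow> real \<Rightarrow> (real \<Rightarrow> real) \<Rightarrow> real \<Rightarrow> real" where
  "RL_left \<alpha> c f x =
     1 / Gamma \<alpha> * (LINT t:{c..x}|lebesgue. (x - t) powr (\<alpha> - 1) * f t)"

definition RL_right :: "real \<Rightarrow> real \<Rightarrow> (real \<Rightarrow> real) \<Rightarrow> real \<Rightarrow> real" where
  "RL_right \<alpha> d f x =
     1 / Gamma \<alpha> * (LINT t:{x..d}|lebesgue. (t - x) powr (\<alpha> - 1) * f t)"

end

theory Submission
  imports Defs
begin

text \<open>
  Write \<open>h = \<eta>(b,a)\<close> and \<open>c = a + h\<close>. Prequasiinvexity along the path from \<open>a\<close> bounds \<open>\<bar>f'\<bar>\<close> on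
  \<open>[a,c]\<close> by the constant \<open>M\<close> on the right-hand side, so \<open>f\<close> is \<open>M\<close>-Lipschitz there.
  Substituting \<open>s = c - t\<close> and \<open>s = t - a\<close> in the two fractional integrals and using
  \<open>\<alpha> \<integral>\<^sub>0\<^sup>h s\<^sup>\<alpha>\<^sup>-\<^sup>1 ds = h\<^sup>\<alpha>\<close>, the left-hand side becomes the absolute value of
  \<open>\<alpha> / (2 h\<^sup>\<alpha>) \<integral>\<^sub>0\<^sup>h s\<^sup>\<alpha>\<^sup>-\<^sup>1 (f(a) + f(c) - f(c-s) - f(a+s)) ds\<close>. The bracket is at most
  \<open>2 M min(s, h-s)\<close>, since its four values can be paired in two ways, and integrating this bound
  gives exactly the claimed constant. No integration by parts is needed.
\<close>

text \<open>For \<alpha> < 1 the kernel blows up at 0, so continuity of the product cannot be used.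
  The kernel is nonnegative and integrable, hence absolutely integrable, and \<open>g\<close> is a
  bounded measurable factor.\<close>

lemma powr_kernel_absolutely_integrable:
  fixes g :: "real \<Rightarrow> real"
  assumes "\<alpha> > 0" "continuous_on {0..h} g"
  shows "(\<lambda>s. s powr (\<alpha> - 1) * g s) absolutely_integrable_on {0..h}"
proof -
  have 1: "(\<lambda>s. s powr (\<alpha> - 1)) absolutely_integrable_on {0..h}"
  proof (cases "0 \<le> h")
    case True
    have "(\<lambda>s. s powr (\<alpha> - 1)) integrable_on {0..h}"
      using has_integral_powr_from_0[of "\<alpha> - 1" h] assms True by (auto simp: integrable_on_def)
    then show ?thesis
      by (intro nonnegative_absolutely_integrable_1) auto
  qed auto
  have "(\<lambda>s. g s * s powr (\<alpha> - 1)) absolutely_integrable_on {0..h}"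
  proof (rule absolutely_integrable_bounded_measurable_product_real[OF _ _ _ 1])
    show "g \<in> borel_measurable (lebesgue_on {0..h})"
      by (intro continuous_imp_measurable_on_sets_lebesgue assms) auto
    show "bounded (g ` {0..h})"
      by (intro compact_imp_bounded compact_continuous_image assms) auto
  qed auto
  then show ?thesis by (simp add: mult.commute)
qed

text \<open>The reflection \<open>t = x - s\<close> moves the singularity to 0, so that both
  fractional integrals get the same kernel on the same interval. Absolute integrability also turns
  the Lebesgue integral into a gauge integral.\<close>

lemma RL_left_eq:
  assumes "\<alpha> > 0" "continuous_on {c..x} f" "c \<le> x"
  shows "RL_left \<alpha> c f x = 1 / Gamma \<alpha> * integral {0..x - c} (\<lambda>s. s powr (\<alpha> - 1) * f (x - s))"
proof -
  let ?g = "\<lambda>s. s powr (\<alpha> - 1) * f (x - s)"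
  have ai: "?g absolutely_integrable_on {0..x - c}"
    by (intro powr_kernel_absolutely_integrable assms
          continuous_on_compose2[OF assms(2)] continuous_intros) auto
  have im: "(\<lambda>t. x - t) ` {c..x} = {0..x - c}"
    using assms by (auto simp: image_iff intro!: bexI[of _ "x - _"])
  have der: "((\<lambda>t. x - t) has_field_derivative -1) (at t within {c..x})" for t
    by (auto intro!: derivative_eq_intros)
  have "(\<lambda>t. \<bar>-1\<bar> *\<^sub>R ?g (x - t)) absolutely_integrable_on {c..x} \<and>
        integral {c..x} (\<lambda>t. \<bar>-1\<bar> *\<^sub>R ?g (x - t)) = integral {0..x - c} ?g"
    using has_absolute_integral_change_of_variables_1'[of "{c..x}" "\<lambda>t. x - t" "\<lambda>_. -1" ?g] der im ai
    by (auto simp: inj_on_def)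
  then show ?thesis
    unfolding RL_left_def by (simp add: set_lebesgue_integral_eq_integral)
qed

lemma RL_right_eq:
  assumes "\<alpha> > 0" "continuous_on {x..d} f" "x \<le> d"
  shows "RL_right \<alpha> d f x = 1 / Gamma \<alpha> * integral {0..d - x} (\<lambda>s. s powr (\<alpha> - 1) * f (x + s))"
proof -
  let ?g = "\<lambda>s. s powr (\<alpha> - 1) * f (x + s)"
  have ai: "?g absolutely_integrable_on {0..d - x}"
    by (intro powr_kernel_absolutely_integrable assms
          continuous_on_compose2[OF assms(2)] continuous_intros) auto
  have im: "(\<lambda>t. t - x) ` {x..d} = {0..d - x}"
    using assms by (auto simp: image_iff intro!: bexI[of _ "x + _"])
  have der: "((\<lambda>t. t - x) has_field_derivative 1) (at t within {x..d})" for t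
    by (auto intro!: derivative_eq_intros)
  have "(\<lambda>t. \<bar>1\<bar> *\<^sub>R ?g (t - x)) absolutely_integrable_on {x..d} \<and>
        integral {x..d} (\<lambda>t. \<bar>1\<bar> *\<^sub>R ?g (t - x)) = integral {0..d - x} ?g"
    using has_absolute_integral_change_of_variables_1'[of "{x..d}" "\<lambda>t. t - x" "\<lambda>_. 1" ?g] der im ai
    by (auto simp: inj_on_def)
  then show ?thesis
    unfolding RL_right_def by (simp add: set_lebesgue_integral_eq_integral)
qed

lemma has_integral_powr_tent:
  fixes h \<alpha> :: real
  assumes "\<alpha> > 0" "h > 0"
  shows "((\<lambda>s. s powr (\<alpha> - 1) * min s (h - s)) has_integral
           h powr (\<alpha> + 1) * (1 - 1 / 2 powr \<alpha>) / (\<alpha> * (\<alpha> + 1))) {0..h}"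
proof -
  let ?k = "\<lambda>s. s powr (\<alpha> - 1) * min s (h - s)"
  \<comment> \<open>An antiderivative of \<open>s powr (\<alpha> - 1) * (h - s)\<close> for
    \<open>s > 0\<close>, used only on the right half, away from the singularity.\<close>
  define F where "F = (\<lambda>s. h * s powr \<alpha> / \<alpha> - s powr (\<alpha> + 1) / (\<alpha> + 1))"
  have "((\<lambda>s. s powr \<alpha>) has_integral (h/2) powr (\<alpha> + 1) / (\<alpha> + 1)) {0..h/2}"
    using has_integral_powr_from_0[of \<alpha> "h/2"] assms by simp
  then have 1: "(?k has_integral (h/2) powr (\<alpha> + 1) / (\<alpha> + 1)) {0..h/2}"
  proof (rule has_integral_eq[rotated])
    fix s assume s: "s \<in> {0..h/2}"
    have "s powr (\<alpha> - 1) * s = s powr \<alpha>"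
      \<comment> \<open>At \<open>s = 0\<close> both sides vanish, by the convention that
        \<open>0 powr r\<close> is 0.\<close>
      using s by (cases "s = 0") (auto simp: powr_diff)
    with s show "s powr \<alpha> = ?k s" by (simp add: min_def)
  qed
  have "((\<lambda>s. s powr (\<alpha> - 1) * (h - s)) has_integral (F h - F (h/2))) {h/2..h}"
  proof (rule fundamental_theorem_of_calculus)
    fix s assume "s \<in> {h/2..h}"
    then have "s > 0" using assms by auto
    have "(F has_field_derivative
        h * (\<alpha> * s powr (\<alpha> - 1)) / \<alpha> - (\<alpha> + 1) * s powr (\<alpha> + 1 - 1) / (\<alpha> + 1)) (at s)"
      unfolding F_def
      by (intro DERIV_diff DERIV_cdivide DERIV_cmult has_real_derivative_powr \<open>s > 0\<close>)
    also have "h * (\<alpha> * s powr (\<alpha> - 1)) / \<alpha> - (\<alpha> + 1) * s powr (\<alpha> + 1 - 1) / (\<alpha> + 1)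
        = s powr (\<alpha> - 1) * (h - s)"
    proof -
      have "\<alpha> + 1 \<noteq> 0" "\<alpha> \<noteq> 0" using assms by auto
      then show ?thesis using \<open>s > 0\<close> by (simp add: powr_diff right_diff_distrib)
    qed
    finally show "(F has_vector_derivative s powr (\<alpha> - 1) * (h - s)) (at s within {h/2..h})"
      by (simp add: has_real_derivative_iff_has_vector_derivative has_vector_derivative_at_within)
  qed (use assms in auto)
  then have 2: "(?k has_integral (F h - F (h/2))) {h/2..h}"
    by (rule has_integral_eq[rotated]) (auto simp: min_def)
  have "(?k has_integral (h/2) powr (\<alpha> + 1) / (\<alpha> + 1) + (F h - F (h/2))) {0..h}"
    by (rule has_integral_combine[OF _ _ 1 2]) (use assms in auto)
  moreover have "(h/2) powr (\<alpha> + 1) / (\<alpha> + 1) + (F h - F (h/2)) =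
      h powr (\<alpha> + 1) * (1 - 1 / 2 powr \<alpha>) / (\<alpha> * (\<alpha> + 1))"
  proof -
    have "\<alpha> + 1 \<noteq> 0" "\<alpha> \<noteq> 0" using assms by auto
    then show ?thesis
      unfolding F_def using assms
      by (simp add: powr_divide powr_add divide_simps) (simp add: algebra_simps)
  qed
  ultimately show ?thesis by simp
qed

lemma fractional_trapezoid_lipschitz:
  fixes f :: "real \<Rightarrow> real"
  assumes "\<alpha> > 0" "h > 0"
    and lip: "\<And>x y. x \<in> {a..a + h} \<Longrightarrow> y \<in> {a..a + h} \<Longrightarrow> \<bar>f x - f y\<bar> \<le> M * \<bar>x - y\<bar>"
  shows "\<bar>(f a + f (a + h)) / 2
           - Gamma (\<alpha> + 1) / (2 * h powr \<alpha>) * (RL_left \<alpha> a f (a + h) + RL_right \<alpha> (a + h) f a)\<bar>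
         \<le> h / (\<alpha> + 1) * (1 - 1 / 2 powr \<alpha>) * M"
proof -
  \<comment> \<open>The sign of \<open>M\<close> comes from the Lipschitz estimate at the two
    endpoints.\<close>
  have "0 \<le> M * h" using lip[of a "a + h"] assms by auto
  then have "M \<ge> 0" using assms by (simp add: zero_le_mult_iff)
  then have "M-lipschitz_on {a..a + h} f"
    using lip by (intro lipschitz_onI) (auto simp: dist_real_def)
  then have cont: "continuous_on {a..a + h} f"
    by (rule lipschitz_on_continuous_on)
  define k where "k = (\<lambda>s::real. s powr (\<alpha> - 1))"
  define S where "S = f a + f (a + h)"
  let ?I = "integral {0..h}"
  have il: "(\<lambda>s. k s * f (a + h - s)) integrable_on {0..h}"
    and ir: "(\<lambda>s. k s * f (a + s)) integrable_on {0..h}"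
    unfolding k_def
    by (intro set_lebesgue_integral_eq_integral(1) powr_kernel_absolutely_integrable assms
          continuous_on_compose2[OF cont] continuous_intros; auto)+
  have ik: "((\<lambda>s. k s * S) has_integral h powr \<alpha> / \<alpha> * S) {0..h}"
    using has_integral_mult_left[OF has_integral_powr_from_0[of "\<alpha> - 1" h], of S] assms
    by (simp add: k_def)
  define J where "J = ?I (\<lambda>s. k s * f (a + h - s)) + ?I (\<lambda>s. k s * f (a + s))"
  have "((\<lambda>s. k s * S - (k s * f (a + h - s) + k s * f (a + s))) has_integral
           h powr \<alpha> / \<alpha> * S - J) {0..h}"
    unfolding J_def
    by (intro has_integral_diff has_integral_add ik integrable_integral il ir)
  then have d: "((\<lambda>s. k s * (S - f (a + h - s) - f (a + s))) has_integral
           h powr \<alpha> / \<alpha> * S - J) {0..h}"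
    by (simp add: algebra_simps)
  have t: "((\<lambda>s. 2 * M * (k s * min s (h - s))) has_integral
      2 * M * (h powr (\<alpha> + 1) * (1 - 1 / 2 powr \<alpha>) / (\<alpha> * (\<alpha> + 1)))) {0..h}"
    unfolding k_def by (intro has_integral_mult_right has_integral_powr_tent assms)
  have "norm (?I (\<lambda>s. k s * (S - f (a + h - s) - f (a + s)))) \<le> ?I (\<lambda>s. 2 * M * (k s * min s (h - s)))"
  proof (rule integral_norm_bound_integral)
    fix s assume s: "s \<in> {0..h}"
    \<comment> \<open>The first two bounds pair each endpoint with its nearby shift and give
      \<open>2 * M * s\<close>; the other two pair crosswise and give
      \<open>2 * M * (h - s)\<close>.\<close>
    have "\<bar>f a - f (a + s)\<bar> \<le> M * s" "\<bar>f (a + h) - f (a + h - s)\<bar> \<le> M * s"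
      "\<bar>f a - f (a + h - s)\<bar> \<le> M * (h - s)" "\<bar>f (a + h) - f (a + s)\<bar> \<le> M * (h - s)"
      using lip[of a "a + s"] lip[of "a + h" "a + h - s"] lip[of a "a + h - s"]
        lip[of "a + h" "a + s"] s by auto
    then have "\<bar>S - f (a + h - s) - f (a + s)\<bar> \<le> 2 * M * min s (h - s)"
      unfolding S_def by (auto simp: min_def)
    then have "k s * \<bar>S - f (a + h - s) - f (a + s)\<bar> \<le> k s * (2 * M * min s (h - s))"
      by (intro mult_left_mono) (auto simp: k_def)
    then show "norm (k s * (S - f (a + h - s) - f (a + s))) \<le> 2 * M * (k s * min s (h - s))"
      by (simp add: abs_mult k_def mult_ac)
  qed (use d t in blast)+
  then have bound: "\<bar>h powr \<alpha> / \<alpha> * S - J\<bar> \<le>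
      2 * M * (h powr (\<alpha> + 1) * (1 - 1 / 2 powr \<alpha>) / (\<alpha> * (\<alpha> + 1)))"
    using integral_unique[OF d] integral_unique[OF t] by simp
  \<comment> \<open>The recurrence for Gamma cancels the normalisation
    \<open>1 / Gamma \<alpha>\<close> and leaves the factor \<alpha>.\<close>
  have "Gamma \<alpha> \<noteq> 0" using Gamma_real_pos[OF assms(1)] by linarith
  moreover have "Gamma (\<alpha> + 1) = \<alpha> * Gamma \<alpha>"
    using assms nonpos_Ints_nonpos[of \<alpha>] by (intro Gamma_plus1) auto
  ultimately have RL: "Gamma (\<alpha> + 1) * (RL_left \<alpha> a f (a + h) + RL_right \<alpha> (a + h) f a) = \<alpha> * J"
    using assms(1,2) cont by (simp add: RL_left_eq RL_right_eq J_def k_def field_simps)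
  \<comment> \<open>Chosen so that \<open>?c * (h powr \<alpha> / \<alpha>)\<close> equals
    1/2.\<close>
  let ?c = "\<alpha> / (2 * h powr \<alpha>)"
  have "(f a + f (a + h)) / 2
      - Gamma (\<alpha> + 1) / (2 * h powr \<alpha>) * (RL_left \<alpha> a f (a + h) + RL_right \<alpha> (a + h) f a)
      = S / 2 - \<alpha> * J / (2 * h powr \<alpha>)"
    by (simp add: S_def flip: RL)
  also have "\<dots> = ?c * (h powr \<alpha> / \<alpha> * S - J)"
    using assms by (simp add: field_simps)
  also have "\<bar>\<dots>\<bar> = ?c * \<bar>h powr \<alpha> / \<alpha> * S - J\<bar>"
    using assms by (simp add: abs_mult)
  also have "\<dots> \<le> ?c * (2 * M * (h powr (\<alpha> + 1) * (1 - 1 / 2 powr \<alpha>) / (\<alpha> * (\<alpha> + 1))))"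
    using assms by (intro mult_left_mono bound) auto
  also have "\<dots> = h / (\<alpha> + 1) * (1 - 1 / 2 powr \<alpha>) * M"
    using assms by (simp add: powr_add)
  finally show ?thesis .
qed

theorem theorem9:
  fixes A :: "real set" and \<eta> :: "real \<Rightarrow> real \<Rightarrow> real" and f :: "real \<Rightarrow> real"
    and a b q \<alpha> :: real
  assumes "open A" and "invex_set A \<eta>"
    and "a \<in> A" and "b \<in> A" and "a < a + \<eta> b a"
    and "f differentiable_on A"
    and "set_integrable lebesgue {a..a + \<eta> b a} (deriv f)"
    and "q > 1"
    and "prequasiinvex_on A \<eta> (\<lambda>x. \<bar>deriv f x\<bar> powr q)"
    and "\<alpha> > 0"
  shows "\<bar>(f a + f (a + \<eta> b a)) / 2
           - Gamma (\<alpha> + 1) / (2 * \<eta> b a powr \<alpha>)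
             * (RL_left \<alpha> a f (a + \<eta> b a) + RL_right \<alpha> (a + \<eta> b a) f a)\<bar>
         \<le> \<eta> b a / (\<alpha> + 1) * (1 - 1 / 2 powr \<alpha>)
            * max (\<bar>deriv f a\<bar> powr q) (\<bar>deriv f b\<bar> powr q) powr (1 / q)"
proof (rule fractional_trapezoid_lipschitz)
  let ?h = "\<eta> b a" and ?m = "max (\<bar>deriv f a\<bar> powr q) (\<bar>deriv f b\<bar> powr q)"
  fix x y assume xy: "x \<in> {a..a + ?h}" "y \<in> {a..a + ?h}"
  have path: "z \<in> A \<and> \<bar>deriv f z\<bar> \<le> ?m powr (1 / q)" if z: "z \<in> {a..a + ?h}" for z
  proof -
    \<comment> \<open>The parameter of \<open>z\<close> on the path from \<open>a\<close>: invexity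
      at \<open>t\<close> puts \<open>z\<close> in \<open>A\<close>, and prequasiinvexity bounds the
      derivative there.\<close>
    define t where "t = (z - a) / ?h"
    have t: "t \<in> {0..1}" "z = a + t * ?h"
      using z assms(5) by (auto simp: t_def divide_simps)
    have "\<bar>deriv f z\<bar> powr q \<le> ?m"
      using assms(3,4,9) t unfolding prequasiinvex_on_def by blast
    then have "(\<bar>deriv f z\<bar> powr q) powr (1 / q) \<le> ?m powr (1 / q)"
      using assms(8) by (intro powr_mono2) auto
    moreover have "z \<in> A"
      using assms(2,3,4) t unfolding invex_set_def by blast
    ultimately show ?thesis
      using assms(8) by (simp add: powr_powr)
  qed
  have "norm (f x - f y) \<le> ?m powr (1 / q) * norm (x - y)"
  proof (rule field_differentiable_bound[of "{a..a + ?h}" f "deriv f"])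
    fix z assume z: "z \<in> {a..a + ?h}"
    have "f differentiable (at z)"
      \<comment> \<open>As \<open>A\<close> is open, differentiability within \<open>A\<close> is
        differentiability at \<open>z\<close>, which makes \<open>deriv f z\<close> the true
        derivative.\<close>
      using path[OF z] assms(1,6) by (metis at_within_open differentiable_on_def)
    then have "(f has_field_derivative deriv f z) (at z)"
      by (simp add: DERIV_deriv_iff_real_differentiable)
    then show "(f has_field_derivative deriv f z) (at z within {a..a + ?h})"
      by (rule has_field_derivative_at_within)
  qed (use path xy in auto)
  then show "\<bar>f x - f y\<bar> \<le> ?m powr (1 / q) * \<bar>x - y\<bar>" by simp
qed (use assms in auto)

end
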